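(* Let $n\ge 2$, let $\Omega,T\subset\mathbb{R}^n$ be bounded domains, let $\beta>0$, and let $I:\Omega\to[0,\infty)$ and $L:T\to[0,\infty)$ be integrable functions with $\int_T L(p)\,dp=\int_\Omega I(x)\,dx$. Let $(z,w)\in C(\bar\Omega)\times C(\bar T)$ be a two-reflector of type A. Then the following statements are equivalent: 1. $(z,w)$ minimizes the functional $$\mathcal F(\zeta,\omega)=\int_\Omega \zeta(x)I(x)\,dx-\int_T\omega(p)L(p)\,dp$$ over the class $Adm(\Omega,T)$ of admissible pairs $(\zeta,\omega)$. 2. $(z,w)$ is a weak solution of type A of the two-reflector problem with data $(\Omega,T,I,L,\beta)$.
   Context: A domain is a nonempty open connected set. Paraboloids: for $p,x\in\mathbb{R}^n$ and real numbers $w,z$, $$k_{p,w}(x)=\frac{\beta^2-|x-p|^2}{2\beta}+w,\qquad h_{x,z}(p)=\frac{|x-p|^2-\beta^2}{2\beta}+z .$$ A pair $(z,w)\in C(\bar\Omega)\times C(\bar T)$ is a two-reflector of type A if $z(x)=\sup_{p\in\bar T}k_{p,w(p)}(x)$ for all $x\in\bar\Omega$ and $w(p)=\inf_{x\in\bar\Omega}h_{x,z(x)}(p)$ for all $p\in\bar T$. Admissible pairs: $Adm(\Omega,T)$ is the set of all $(\zeta,\omega)\in C(\bar\Omega)\times C(\bar T)$ such that $$\zeta(x)-\omega(p)\ge\frac{1}{2\beta}\left(\beta^2-|x-p|^2\right)\quad\text{for all }x\in\bar\Omega,\ p\in\bar T.$$ (Equivalently, $\zeta(x)-\omega(p)+\sqrt{(\zeta(x)-\omega(p))^2+|x-p|^2}\ge\beta$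 for all such $x,p$. Every two-reflector of type A is admissible.) Ray tracing map of a two-reflector $(z,w)$ of type A: put $Q(x,p)=\langle x,p\rangle+\beta w(p)-\frac{|p|^2}{2}$ and $V^*(x)=\sup_{p\in\bar T}Q(x,p)$, $x\in\mathbb{R}^n$ (a convex function); $\tilde P(x)$ is the set of all $p\in\mathbb{R}^n$ with $V^*(y)\ge V^*(x)+\langle p,y-x\rangle$ for all $y\in\mathbb{R}^n$ (the subdifferential of $V^*$ at $x$). Extend $I$ by $0$ to $\mathbb{R}^n$. For a Borel set $\tau\subseteq T$ put $\tilde P^{-1}(\tau)=\{x\in\mathbb{R}^n:\tilde P(x)\cap\tau\neq\emptyset\}$ (a Lebesgue measurable set). A two-reflector $(z,w)$ of type A is a weak solution of type A of the two-reflector problem with data $(\Omega,T,I,L,\beta)$ if (i) $\tilde P:\bar\Omega\to\bar T$ is onto, i.e. for every $p\in\bar T$ there is $x\in\bar\Omega$ with $p\in\tilde P(x)$, and (ii) $\int_{\tilde P^{-1}(\tau)}I(x)\,dx=\int_\tau L(p)\,dp$ for every Borel set $\tau\subseteq T$. *)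

theory Defs
  imports "HOL-Analysis.Analysis"
begin

definition is_domain :: "(real^'n) set \<Rightarrow> bool" where
  "is_domain S \<longleftrightarrow> S \<noteq> {} \<and> open S \<and> connected S"

definition parab_k :: "real \<Rightarrow> real^'n \<Rightarrow> real \<Rightarrow> real^'n \<Rightarrow> real" where
  "parab_k \<beta> p w x = (\<beta>\<^sup>2 - (norm (x - p))\<^sup>2) / (2 * \<beta>) + w"

definition parab_h :: "real \<Rightarrow> real^'n \<Rightarrow> real \<Rightarrow> real^'n \<Rightarrow> real" where
  "parab_h \<beta> x z p = ((norm (x - p))\<^sup>2 - \<beta>\<^sup>2) / (2 * \<beta>) + z"

text \<open>
  An element of \<open>C(closure S)\<close> is represented by a total function that is continuous on
  \<open>closure S\<close>; no definition below looks at its values elsewhere. All suprema and infima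
  below are taken over bounded nonempty families of reals as soon as \<open>\<Omega>\<close> and \<open>T\<close> are bounded
  domains and the functions are continuous on the closures, so they are the genuine ones.
\<close>

definition two_reflector_A ::
    "(real^'n) set \<Rightarrow> (real^'n) set \<Rightarrow> real \<Rightarrow> (real^'n \<Rightarrow> real) \<Rightarrow> (real^'n \<Rightarrow> real) \<Rightarrow> bool" where
  "two_reflector_A \<Omega> T \<beta> z w \<longleftrightarrow>
     continuous_on (closure \<Omega>) z \<and> continuous_on (closure T) w \<and>
     (\<forall>x\<in>closure \<Omega>. z x = (SUP p\<in>closure T. parab_k \<beta> p (w p) x)) \<and>
     (\<forall>p\<in>closure T. w p = (INF x\<in>closure \<Omega>. parab_h \<beta> x (z x) p))"

definition Adm ::
    "(real^'n) set \<Rightarrow> (real^'n) set \<Rightarrow> real \<Rightarrow> ((real^'n \<Rightarrow> real) \<times> (real^'n \<Rightarrow> real)) set" where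
  "Adm \<Omega> T \<beta> = {(\<zeta>, \<omega>).
     continuous_on (closure \<Omega>) \<zeta> \<and> continuous_on (closure T) \<omega> \<and>
     (\<forall>x\<in>closure \<Omega>. \<forall>p\<in>closure T.
        \<zeta> x - \<omega> p \<ge> 1 / (2 * \<beta>) * (\<beta>\<^sup>2 - (norm (x - p))\<^sup>2))}"

definition transport_functional ::
    "(real^'n) set \<Rightarrow> (real^'n) set \<Rightarrow> (real^'n \<Rightarrow> real) \<Rightarrow> (real^'n \<Rightarrow> real) \<Rightarrow>
     (real^'n \<Rightarrow> real) \<times> (real^'n \<Rightarrow> real) \<Rightarrow> real" where
  "transport_functional \<Omega> T I L = (\<lambda>(\<zeta>, \<omega>).
     (LINT x:\<Omega>|lebesgue. \<zeta> x * I x) - (LINT p:T|lebesgue. \<omega> p * L p))"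

definition Qfun :: "real \<Rightarrow> (real^'n \<Rightarrow> real) \<Rightarrow> real^'n \<Rightarrow> real^'n \<Rightarrow> real" where
  "Qfun \<beta> w x p = x \<bullet> p + \<beta> * w p - (norm p)\<^sup>2 / 2"

definition Vstar :: "(real^'n) set \<Rightarrow> real \<Rightarrow> (real^'n \<Rightarrow> real) \<Rightarrow> real^'n \<Rightarrow> real" where
  "Vstar T \<beta> w x = (SUP p\<in>closure T. Qfun \<beta> w x p)"

definition subdifferential :: "(real^'n \<Rightarrow> real) \<Rightarrow> real^'n \<Rightarrow> (real^'n) set" where
  "subdifferential f x = {p. \<forall>y. f y \<ge> f x + p \<bullet> (y - x)}"

definition ray_map :: "(real^'n) set \<Rightarrow> real \<Rightarrow> (real^'n \<Rightarrow> real) \<Rightarrow> real^'n \<Rightarrow> (real^'n) set" where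
  "ray_map T \<beta> w x = subdifferential (Vstar T \<beta> w) x"

definition ray_map_preimage ::
    "(real^'n) set \<Rightarrow> real \<Rightarrow> (real^'n \<Rightarrow> real) \<Rightarrow> (real^'n) set \<Rightarrow> (real^'n) set" where
  "ray_map_preimage T \<beta> w \<tau> = {x. ray_map T \<beta> w x \<inter> \<tau> \<noteq> {}}"

text \<open>
  The preimage of a Borel set under the set-valued ray tracing map is Lebesgue measurable, but
  need not be Borel a priori, hence \<open>lebesgue\<close> rather than \<open>lborel\<close>.
\<close>

definition weak_solution_A ::
    "(real^'n) set \<Rightarrow> (real^'n) set \<Rightarrow> (real^'n \<Rightarrow> real) \<Rightarrow> (real^'n \<Rightarrow> real) \<Rightarrow> real \<Rightarrow>
     (real^'n \<Rightarrow> real) \<Rightarrow> (real^'n \<Rightarrow> real) \<Rightarrow> bool" where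
  "weak_solution_A \<Omega> T I L \<beta> z w \<longleftrightarrow>
     two_reflector_A \<Omega> T \<beta> z w \<and>
     (\<forall>p\<in>closure T. \<exists>x\<in>closure \<Omega>. p \<in> ray_map T \<beta> w x) \<and>
     (\<forall>\<tau>. \<tau> \<in> sets borel \<and> \<tau> \<subseteq> T \<longrightarrow>
        (LINT x:ray_map_preimage T \<beta> w \<tau>|lebesgue. (if x \<in> \<Omega> then I x else 0)) =
        (LINT p:\<tau>|lebesgue. L p))"

end

theory Submission
  imports Defs
begin

text \<open>
  Put \<open>c x p = (\<beta>\<^sup>2 - |x - p|\<^sup>2) / (2 * \<beta>)\<close>. Up to a function of \<open>x\<close> alone and the factor
  \<open>\<beta>\<close>, \<open>z\<close> is the maximum of the affine functions \<open>Q(\<cdot>, p)\<close>, so an admissible pair satisfies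
  \<open>\<zeta> x - \<omega> p \<ge> c x p\<close>, with equality for \<open>(z, w)\<close> when \<open>p\<close> maximizes \<open>Q(x, \<cdot>)\<close>. The convex
  function \<open>V*\<close> has a unique subgradient almost everywhere, hence the ray tracing map is almost
  everywhere a measurable function \<open>P\<close>. Both statements of the theorem are equivalent to: the
  image of \<open>I dx\<close> under \<open>P\<close> is \<open>L dp\<close>. This gives minimality by integrating
  \<open>\<zeta> x - \<omega> (P x) \<ge> c x (P x)\<close>; conversely, perturbing \<open>w\<close> to \<open>w + \<epsilon> g\<close> with \<open>g\<close> continuous
  changes \<open>z\<close> at the rate \<open>g (P x)\<close>, so minimality forces \<open>\<integral> g (P x) I dx = \<integral> g L dp\<close>.
\<close>

section \<open>Subgradients: closed graph, Borel preimages, uniqueness almost everywhere\<close>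

text \<open>The translates of \<open>E\<close> by \<open>b / (n + 1)\<close> are pairwise disjoint,
  have equal measure and lie in one ball. Infinitely many equal measures with a finite sum must
  vanish.\<close>

lemma negligible_disjoint_translates:
  fixes E :: "'a::euclidean_space set"
  assumes "compact E" and disj: "\<And>x t. x \<in> E \<Longrightarrow> t > 0 \<Longrightarrow> x + t *\<^sub>R b \<notin> E"
  shows "negligible E"
proof -
  define A where "A n = (\<lambda>x. (1 / real (Suc n)) *\<^sub>R b + x) ` E" for n :: nat
  have cA: "compact (A n)" for n
    unfolding A_def using assms(1) by (rule compact_translation)
  have dA: "disjoint_family A"
    unfolding disjoint_family_on_def
  proof (intro ballI impI, rule ccontr)
    fix m n :: nat assume "m \<noteq> n" "A m \<inter> A n \<noteq> {}"
    then obtain x y where xy: "x \<in> E" "y \<in> E"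
      "(1 / real (Suc m)) *\<^sub>R b + x = (1 / real (Suc n)) *\<^sub>R b + y"
      unfolding A_def by blast
    have e: "x + (1 / real (Suc m) - 1 / real (Suc n)) *\<^sub>R b = y"
      "y + (1 / real (Suc n) - 1 / real (Suc m)) *\<^sub>R b = x"
      using xy(3) by (simp_all add: scaleR_diff_left algebra_simps)
    \<comment> \<open>Whichever sign the difference of the two shifts has, one of \<open>x\<close>
      and \<open>y\<close> is a positive shift of the other along \<open>b\<close>.\<close>
    have "1 / real (Suc m) \<noteq> 1 / real (Suc n)" using \<open>m \<noteq> n\<close> by simp
    then have "1 / real (Suc m) - 1 / real (Suc n) > 0 \<or> 1 / real (Suc n) - 1 / real (Suc m) > 0"
      by linarith
    then show False
      using disj[OF xy(1)] disj[OF xy(2)] e xy(1,2) by metis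
  qed
  obtain B where B: "\<And>x. x \<in> E \<Longrightarrow> norm x \<le> B"
    using compact_imp_bounded[OF assms(1)] unfolding bounded_iff by blast
  have sub: "A n \<subseteq> cball 0 (norm b + B)" for n
  proof
    fix y assume "y \<in> A n"
    then obtain x where x: "x \<in> E" "y = (1 / real (Suc n)) *\<^sub>R b + x" unfolding A_def by blast
    have "norm y \<le> norm ((1 / real (Suc n)) *\<^sub>R b) + norm x" using x norm_triangle_ineq by blast
    also have "norm ((1 / real (Suc n)) *\<^sub>R b) \<le> 1 * norm b"
      unfolding norm_scaleR by (intro mult_right_mono) (auto simp: field_simps)
    finally show "y \<in> cball 0 (norm b + B)" using B[OF x(1)] by simp
  qed
  have meas: "A n \<in> sets lebesgue" for n
    using cA[of n] by (simp add: borel_compact)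
  have "emeasure lebesgue (\<Union>n. A n) \<le> emeasure lebesgue (cball (0::'a) (norm b + B))"
    by (rule emeasure_mono) (use sub in blast, simp)
  also have "\<dots> < \<infinity>"
    using lmeasurable_compact[OF compact_cball, of "0::'a" "norm b + B"] by (simp add: fmeasurable_def)
  finally have "emeasure lebesgue (\<Union>n. A n) \<noteq> \<infinity>" by simp
  then have "(\<lambda>n. measure lebesgue (A n)) sums measure lebesgue (\<Union>n. A n)"
    using meas dA by (intro measure_UNION) auto
  moreover have "measure lebesgue (A n) = measure lebesgue E" for n
    unfolding A_def by (rule measure_translation)
  ultimately have "summable (\<lambda>n::nat. measure lebesgue E)"
    by (simp add: sums_iff)
  then have "measure lebesgue E = 0" by (simp add: summable_const_iff)
  then show ?thesis
    using assms(1) lmeasurable_compact negligible_iff_measure by blast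
qed

text \<open>A projection of a closed set need not be closed, but \<open>G\<close> is the union of
  its compact intersections with the balls of radius \<open>k\<close>, and these have compact
  projections.\<close>

lemma borel_fst_image_closed:
  fixes G :: "('a::euclidean_space \<times> 'b::euclidean_space) set"
  assumes "closed G"
  shows "fst ` G \<in> sets borel"
proof -
  have "compact (fst ` (G \<inter> cball 0 (real k)))" for k
    using assms by (intro compact_continuous_image closed_Int_compact continuous_intros) auto
  then have "(\<Union>k. fst ` (G \<inter> cball 0 (real k))) \<in> sets borel"
    by (intro sets.countable_UN) (auto intro: borel_compact)
  moreover have "G = (\<Union>k. G \<inter> cball 0 (real k))"
    using real_arch_simple by auto
  then have "fst ` G = (\<Union>k. fst ` (G \<inter> cball 0 (real k)))"
    by (metis image_UN)
  ultimately show ?thesis by simp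
qed

lemma subdifferential_mono:
  assumes "p \<in> subdifferential f x" "q \<in> subdifferential f y"
  shows "(q - p) \<bullet> (y - x) \<ge> 0"
proof -
  have "f y \<ge> f x + p \<bullet> (y - x)" "f x \<ge> f y + q \<bullet> (x - y)"
    using assms unfolding subdifferential_def by auto
  then show ?thesis by (simp add: inner_diff_left inner_diff_right)
qed

text \<open>For fixed \<open>y\<close> the subgradient inequality is a weak inequality between
  continuous functions of \<open>(x, p)\<close>; the graph is the intersection of these closed sets
  over all \<open>y\<close>.\<close>

lemma closed_graph_subdifferential:
  fixes f :: "real^'n \<Rightarrow> real"
  assumes "continuous_on UNIV f"
  shows "closed {u. snd u \<in> subdifferential f (fst u)}"
proof -
  have "continuous_on UNIV (\<lambda>u::(real^'n) \<times> (real^'n). f (fst u))"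
    using assms by (intro continuous_on_compose2[OF assms]) (auto intro: continuous_intros)
  then show ?thesis
    unfolding subdifferential_def mem_Collect_eq
    by (intro closed_Collect_all closed_Collect_le continuous_intros) 
qed

text \<open>Lifts a closed relation to triples \<open>(x, p, q)\<close>, so that two subgradients at
  the same point can be treated together.\<close>

lemma closed_fst_snd_preimage:
  assumes "closed {u. R (fst u) (snd u)}"
  shows "closed {u. R (fst u) (fst (snd u))}" "closed {u. R (fst u) (snd (snd u))}"
proof -
  have *: "closed ((\<lambda>u. (fst u, fst (snd u))) -` {u. R (fst u) (snd u)})"
    by (intro closed_vimage assms continuous_intros)
  show "closed {u. R (fst u) (fst (snd u))}"
    using * by (simp add: vimage_def)
  have *: "closed ((\<lambda>u. (fst u, snd (snd u))) -` {u. R (fst u) (snd u)})"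
    by (intro closed_vimage assms continuous_intros)
  show "closed {u. R (fst u) (snd (snd u))}"
    using * by (simp add: vimage_def)
qed

text \<open>The preimage is the first projection of the part of the closed graph that lies over
  \<open>C\<close> in the second component.\<close>

lemma borel_subdifferential_preimage:
  fixes f :: "real^'n \<Rightarrow> real"
  assumes "continuous_on UNIV f" "closed C"
  shows "{x. subdifferential f x \<inter> C \<noteq> {}} \<in> sets borel"
proof -
  have "closed ({u. snd u \<in> subdifferential f (fst u)} \<inter> snd -` C)"
    by (intro closed_Int closed_graph_subdifferential closed_vimage assms continuous_intros)
  moreover have "{x. subdifferential f x \<inter> C \<noteq> {}} =
      fst ` ({u. snd u \<in> subdifferential f (fst u)} \<inter> snd -` C)" (is "?A = fst ` ?G")
  proof
    show "?A \<subseteq> fst ` ?G"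
    proof
      fix x assume "x \<in> ?A"
      then obtain p where "p \<in> subdifferential f x" "p \<in> C" by blast
      then have "(x, p) \<in> ?G" by simp
      then show "x \<in> fst ` ?G" by (rule image_eqI[rotated]) simp
    qed
  qed auto
  ultimately show ?thesis by (simp only: borel_fst_image_closed)
qed

text \<open>
  By monotonicity of the subdifferential, the points at which the \<open>b\<close>-components of the
  subgradients straddle a given gap \<open>(r, s)\<close> meet every line in direction \<open>b\<close> at most once.
\<close>
lemma negligible_subdifferential_not_unique:
  fixes f :: "real^'n \<Rightarrow> real"
  assumes "continuous_on UNIV f"
  shows "negligible {x. \<exists>p q. p \<in> subdifferential f x \<and> q \<in> subdifferential f x \<and> p \<noteq> q}"
proof -
  \<comment> \<open>\<open>G b r s\<close> consists of triples \<open>(x, p, q)\<close> with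
    subgradients \<open>p\<close>, \<open>q\<close> at \<open>x\<close> on either side of the gap.
    Intersecting with a ball before projecting makes \<open>E\<close> compact, as the translation
    argument requires.\<close>
  define G where "G b r s = {u. fst (snd u) \<in> subdifferential f (fst u)
      \<and> snd (snd u) \<in> subdifferential f (fst u) \<and> fst (snd u) \<bullet> b \<le> r \<and> s \<le> snd (snd u) \<bullet> b}"
    for b r s
  define E where "E b r s k = fst ` (G b r s \<inter> cball 0 (real k))" for b r s k
  have clG: "closed (G b r s)" for b r s
    unfolding G_def
    using closed_fst_snd_preimage[of "\<lambda>x p. p \<in> subdifferential f x",
        OF closed_graph_subdifferential[OF assms]]
    by (intro closed_Collect_conj closed_Collect_le continuous_intros) 
  have neg: "negligible (E b r s k)" if "r < s" for b r s k
  proof (rule negligible_disjoint_translates)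
    show "compact (E b r s k)" unfolding E_def
      using clG by (intro compact_continuous_image closed_Int_compact continuous_intros) auto
  next
    fix x and t :: real
    assume x: "x \<in> E b r s k" and t: "t > 0"
    show "x + t *\<^sub>R b \<notin> E b r s k"
    proof
      assume y: "x + t *\<^sub>R b \<in> E b r s k"
      obtain q where q: "q \<in> subdifferential f x" "s \<le> q \<bullet> b"
        using x unfolding E_def G_def by auto
      obtain p where p: "p \<in> subdifferential f (x + t *\<^sub>R b)" "p \<bullet> b \<le> r"
        using y unfolding E_def G_def by auto
      \<comment> \<open>Monotonicity between \<open>x\<close> and its shift contradicts
        \<open>p \<bullet> b \<le> r < s \<le> q \<bullet> b\<close>.\<close>
      have "t * ((p - q) \<bullet> b) \<ge> 0" using subdifferential_mono[OF q(1) p(1)] by simp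
      then have "(p - q) \<bullet> b \<ge> 0" using t by (simp add: zero_le_mult_iff)
      then show False using p q that by (simp add: inner_diff_left)
    qed
  qed
  \<comment> \<open>Basis directions, rational gaps and integer radii catch every pair of distinct
    subgradients, and there are only countably many of them.\<close>
  define J where "J = {(b, r, s, k::nat). b \<in> (Basis :: (real^'n) set) \<and> r \<in> \<rat> \<and> s \<in> \<rat> \<and> (r::real) < s}"
  have "J \<subseteq> Basis \<times> \<rat> \<times> \<rat> \<times> UNIV" unfolding J_def by auto
  moreover have "countable ((Basis :: (real^'n) set) \<times> (\<rat>::real set) \<times> (\<rat>::real set) \<times> (UNIV::nat set))"
    by (intro countable_SIGMA countable_rat countable_finite[OF finite_Basis]) auto
  ultimately have cJ: "countable J" using countable_subset by blast
  have "negligible (\<Union>(b, r, s, k)\<in>J. E b r s k)"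
  proof (rule negligible_countable_Union)
    show "countable ((\<lambda>(b, r, s, k). E b r s k) ` J)" using cJ by simp
  qed (auto simp: J_def neg)
  moreover have "{x. \<exists>p q. p \<in> subdifferential f x \<and> q \<in> subdifferential f x \<and> p \<noteq> q}
      \<subseteq> (\<Union>(b, r, s, k)\<in>J. E b r s k)"
  proof safe
    fix x p q
    assume pq: "p \<in> subdifferential f x" "q \<in> subdifferential f x" "p \<noteq> q"
    have *: "x \<in> (\<Union>(b, r, s, k)\<in>J. E b r s k)"
      if pq: "p \<in> subdifferential f x" "q \<in> subdifferential f x"
        and b: "b \<in> Basis" "p \<bullet> b < q \<bullet> b" for p q b
    proof -
      obtain r where r: "r \<in> \<rat>" "p \<bullet> b < r" "r < q \<bullet> b" using Rats_dense_in_real[OF b(2)] by blast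
      obtain s where s: "s \<in> \<rat>" "r < s" "s < q \<bullet> b" using Rats_dense_in_real[OF r(3)] by blast
      obtain k :: nat where k: "norm (x, p, q) \<le> real k" using real_arch_simple by blast
      have "(x, p, q) \<in> G b r s \<inter> cball 0 (real k)" using pq r s k unfolding G_def by auto
      then have "x \<in> E b r s k" unfolding E_def by force
      moreover have "(b, r, s, k) \<in> J" unfolding J_def using b r s by auto
      ultimately show ?thesis by blast
    qed
    obtain b where "b \<in> Basis" "p \<bullet> b \<noteq> q \<bullet> b" using pq(3) by (meson euclidean_eqI)
    then show "x \<in> (\<Union>(b, r, s, k)\<in>J. E b r s k)"
      using *[OF pq(1,2)] *[OF pq(2,1)] by (cases "p \<bullet> b < q \<bullet> b") auto
  qed
  ultimately show ?thesis using negligible_subset by blast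
qed

section \<open>Testing measures by continuous functions, and differentiating a maximum\<close>

text \<open>The closed sets form an intersection-stable generator of the Borel sets, and the
  indicator of a closed set is a pointwise limit of continuous functions with values in
  \<open>[0, 1]\<close>. Dominated convergence applies because the measures are finite.\<close>

lemma finite_borel_measure_eqI:
  fixes M N :: "'a::metric_space measure"
  assumes "finite_measure M" "finite_measure N"
    and sets: "sets M = sets borel" "sets N = sets borel"
    and eq: "\<And>g::'a \<Rightarrow> real. continuous_on UNIV g \<Longrightarrow> (\<And>x. \<bar>g x\<bar> \<le> 1) \<Longrightarrow>
      integral\<^sup>L M g = integral\<^sup>L N g"
  shows "M = N"
proof -
  interpret M: finite_measure M by fact
  interpret N: finite_measure N by fact
  have meas_closed: "measure M C = measure N C" if C: "closed C" for C
  \<comment> \<open>The empty set is treated apart: \<open>infdist x {}\<close> is \<open>0\<close>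
    by convention, so the functions \<open>g k\<close> below would all be \<open>1\<close>.\<close>
  proof (cases "C = {}")
    case False
    define g where "g k x = max 0 (1 - real k * infdist x C)" for k x
    have cont: "continuous_on UNIV (g k)" for k
      unfolding g_def by (intro continuous_intros)
    have bd: "\<bar>g k x\<bar> \<le> 1" for k x
      unfolding g_def using infdist_nonneg[of x C] by simp
    have lim: "(\<lambda>k. g k x) \<longlonglongrightarrow> indicator C x" for x
    proof (cases "x \<in> C")
      case True
      then have "g k x = 1" for k unfolding g_def by simp
      then show ?thesis using True by simp
    next
      case nin: False
      then have pos: "infdist x C > 0"
        using C False by (metis in_closed_iff_infdist_zero infdist_nonneg order_le_less)
      obtain K :: nat where K: "1 < real K * infdist x C" using reals_Archimedean3[OF pos] by blast
      have "g k x = 0" if "k \<ge> K" for k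
      proof -
        have "real K * infdist x C \<le> real k * infdist x C"
          using that pos by (intro mult_right_mono) auto
        then show ?thesis unfolding g_def using K by simp
      qed
      then have "eventually (\<lambda>k. g k x = 0) sequentially"
        unfolding eventually_sequentially by blast
      then show ?thesis using nin by (simp add: tendsto_eventually)
    qed
    have "(\<lambda>k. integral\<^sup>L Q (g k)) \<longlonglongrightarrow> measure Q C"
      if "finite_measure Q" "sets Q = sets borel" for Q
    proof -
      interpret Q: finite_measure Q by fact
      have [measurable]: "C \<in> sets Q" using C that by simp
      have "g k \<in> borel_measurable Q" for k
        using borel_measurable_continuous_onI[OF cont] measurable_cong_sets[OF that(2) refl] by blast
      then have "(\<lambda>k. integral\<^sup>L Q (g k)) \<longlonglongrightarrow> integral\<^sup>L Q (indicator C)"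
        using lim bd by (intro integral_dominated_convergence[where w="\<lambda>_. 1"]) auto
      then show ?thesis using \<open>C \<in> sets Q\<close> by (simp add: sets.Int_space_eq2)
    qed
    from this[OF assms(1) sets(1)] this[OF assms(2) sets(2)] show ?thesis
      using eq[OF cont bd] LIMSEQ_unique by simp
  qed simp
  show ?thesis
  proof (rule measure_eqI_generator_eq[where E="Collect closed" and \<Omega>=UNIV and A="\<lambda>_. UNIV"])
    show "Int_stable (Collect closed :: 'a set set)"
      unfolding Int_stable_def by auto
    show "emeasure M X = emeasure N X" if "X \<in> Collect closed" for X
      using that meas_closed by (simp add: M.emeasure_eq_measure N.emeasure_eq_measure)
    show "sets M = sigma_sets UNIV (Collect closed)" "sets N = sigma_sets UNIV (Collect closed)"
      using sets by (auto simp: borel_eq_closed)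
  qed auto
qed

text \<open>A case of Danskin's theorem.\<close>
lemma SUP_perturbation_tendsto:
  fixes f g :: "'a::metric_space \<Rightarrow> real"
  assumes K: "compact K" and f: "continuous_on K f" and g: "continuous_on K g"
    and p0: "p0 \<in> K" and uniq: "\<And>p. p \<in> K \<Longrightarrow> p \<noteq> p0 \<Longrightarrow> f p < f p0"
    and e: "\<And>k. e k > 0" "e \<longlonglongrightarrow> 0"
  shows "(\<lambda>k. ((SUP p\<in>K. f p + e k * g p) - f p0) / e k) \<longlonglongrightarrow> g p0"
proof -
  define D where "D k = ((SUP p\<in>K. f p + e k * g p) - f p0) / e k" for k
  have "compact (g ` K)" using K g by (intro compact_continuous_image)
  then obtain B where B: "\<And>p. p \<in> K \<Longrightarrow> \<bar>g p\<bar> \<le> B"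
    using compact_imp_bounded[of "g ` K"] unfolding bounded_iff by auto
  have cont: "continuous_on K (\<lambda>p. f p + e k * g p)" for k
    using f g by (intro continuous_intros)
  have att: "\<exists>p\<in>K. (SUP q\<in>K. f q + e k * g q) = f p + e k * g p
      \<and> (\<forall>q\<in>K. f q + e k * g q \<le> f p + e k * g p)" for k
  proof -
    obtain p where p: "p \<in> K" "\<forall>q\<in>K. f q + e k * g q \<le> f p + e k * g p"
      using continuous_attains_sup[OF K _ cont] p0 by blast
    then have "(SUP q\<in>K. f q + e k * g q) = f p + e k * g p"
      by (intro cSup_eq_maximum) auto
    with p show ?thesis by blast
  qed
  \<comment> \<open>The single competitor \<open>p0\<close> in the supremum already gives this
    bound, for every \<open>k\<close>.\<close>
  have lower: "g p0 \<le> D k" for k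
  proof -
    have "f p0 + e k * g p0 \<le> (SUP q\<in>K. f q + e k * g q)" using att[of k] p0 by force
    then show ?thesis unfolding D_def using e(1)[of k] by (simp add: field_simps)
  qed
  have upper: "eventually (\<lambda>k. D k < g p0 + \<eta>) sequentially" if \<eta>: "\<eta> > 0" for \<eta>
  proof -
    \<comment> \<open>On the compact set \<open>C\<close>, where \<open>g\<close> is too large,
      \<open>f\<close> stays below its maximum by a fixed \<open>\<delta>\<close>. Once
      \<open>2 * B * e k < \<delta>\<close>, a maximizer of the perturbed function cannot lie in
      \<open>C\<close>.\<close>
    define C where "C = {p \<in> K. g p0 + \<eta> \<le> g p}"
    have "closed C" unfolding C_def
      using K g by (intro continuous_closed_preimage_constant continuous_on_closed_Collect_le
          continuous_intros compact_imp_closed)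
    then have "compact (K \<inter> C)" using K by blast
    then have C: "compact C" "C \<subseteq> K" unfolding C_def by (auto simp: Int_def conj_ac)
    have "\<exists>\<delta>>0. \<forall>p\<in>C. f p \<le> f p0 - \<delta>"
    proof (cases "C = {}")
      case False
      then obtain q where q: "q \<in> C" "\<forall>p\<in>C. f p \<le> f q"
        using continuous_attains_sup[OF C(1)] continuous_on_subset[OF f C(2)] by blast
      then have "f q < f p0" using uniq \<eta> unfolding C_def by fastforce
      then show ?thesis using q by (intro exI[of _ "f p0 - f q"]) auto
    qed (auto intro: zero_less_one)
    then obtain \<delta> where \<delta>: "\<delta> > 0" "\<And>p. p \<in> C \<Longrightarrow> f p \<le> f p0 - \<delta>" by blast
    have "(\<lambda>k. e k * (2 * B)) \<longlonglongrightarrow> 0 * (2 * B)" using e(2) by (intro tendsto_intros)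
    then have "eventually (\<lambda>k. e k * (2 * B) < \<delta>) sequentially"
      using \<delta>(1) by (simp add: order_tendstoD(2))
    then show ?thesis
    proof eventually_elim
      case (elim k)
      obtain p where p: "p \<in> K" "(SUP q\<in>K. f q + e k * g q) = f p + e k * g p"
        "f p0 + e k * g p0 \<le> f p + e k * g p"
        using att[of k] p0 by blast
      have "e k * g p \<le> e k * B" "e k * (- B) \<le> e k * g p0"
        using B[OF p(1)] B[OF p0] e(1)[of k] by (intro mult_left_mono; force simp: abs_le_iff)+
      then have "f p > f p0 - \<delta>" using p(3) elim by linarith
      then have "g p < g p0 + \<eta>" using \<delta>(2)[of p] p(1) unfolding C_def by force
      \<comment> \<open>Since \<open>f p\<close> does not exceed \<open>f p0\<close>, the gain in
        the maximum is at most \<open>e k * g p\<close>.\<close>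
      moreover have "f p \<le> f p0" using uniq[OF p(1)] by (cases "p = p0") auto
      then have "D k \<le> g p" unfolding D_def p(2) using e(1)[of k] by (simp add: field_simps)
      ultimately show ?case by simp
    qed
  qed
  have "D \<longlonglongrightarrow> g p0"
  proof (rule order_tendstoI)
    show "eventually (\<lambda>k. a < D k) sequentially" if "a < g p0" for a
      using lower that by (auto intro: always_eventually less_le_trans)
    show "eventually (\<lambda>k. D k < a) sequentially" if "g p0 < a" for a
      using upper[of "a - g p0"] that by simp
  qed
  then show ?thesis unfolding D_def .
qed

section \<open>Measures with an integrable density\<close>

lemma borel_measurable_lebesgueI: "f \<in> borel \<rightarrow>\<^sub>M N \<Longrightarrow> f \<in> lebesgue \<rightarrow>\<^sub>M N"
  by (intro measurable_completion) simp

text \<open>Elements of \<open>C(K)\<close> are represented by total functions with arbitrary values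
  off \<open>K\<close>. Cutting them off by zero gives bounded Borel functions, which are integrable
  against the finite measures below.\<close>

lemma indicator_extension:
  fixes h :: "'a::euclidean_space \<Rightarrow> real"
  assumes "compact K" "continuous_on K h"
  shows "(\<lambda>x. indicator K x * h x) \<in> borel_measurable borel" "\<exists>B. \<forall>x. \<bar>indicator K x * h x\<bar> \<le> B"
proof -
  show "(\<lambda>x. indicator K x * h x) \<in> borel_measurable borel"
    using borel_measurable_continuous_on_indicator[OF _ assms(2)] borel_compact[OF assms(1)] by simp
  obtain B where "\<And>x. x \<in> K \<Longrightarrow> \<bar>h x\<bar> \<le> B"
    using compact_imp_bounded[OF compact_continuous_image[OF assms(2,1)]]
    unfolding bounded_iff by auto
  then have "\<bar>indicator K x * h x\<bar> \<le> max B 0" for x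
    by (fastforce simp: indicator_def)
  then show "\<exists>B. \<forall>x. \<bar>indicator K x * h x\<bar> \<le> B" by blast
qed

text \<open>The indicator belongs to the density because nothing is known about \<open>f\<close> off
  \<open>S\<close>. The base measure is \<open>lebesgue\<close> because the selection
  \<open>ray\<close> below is shown to be measurable with respect to Lebesgue sets.\<close>

definition weighted_measure :: "'a::euclidean_space set \<Rightarrow> ('a \<Rightarrow> real) \<Rightarrow> 'a measure" where
  "weighted_measure S f = density lebesgue (\<lambda>x. ennreal (indicator S x * f x))"

context
  fixes S :: "'a::euclidean_space set" and f :: "'a \<Rightarrow> real"
  assumes int: "set_integrable lebesgue S f" and nonneg: "\<And>x. x \<in> S \<Longrightarrow> f x \<ge> 0"
begin

lemma weight_measurable: "(\<lambda>x. indicator S x * f x) \<in> borel_measurable lebesgue"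
  using int unfolding set_integrable_def by (simp add: borel_measurable_integrable)

lemma sets_weighted_measure [measurable_cong]: "sets (weighted_measure S f) = sets lebesgue"
  unfolding weighted_measure_def by simp

lemma finite_weighted_measure: "finite_measure (weighted_measure S f)"
proof
  have "integrable lebesgue (\<lambda>x. indicator S x * f x)"
    using int unfolding set_integrable_def by simp
  moreover have "emeasure (weighted_measure S f) (space (weighted_measure S f)) =
      (\<integral>\<^sup>+x. ennreal (indicator S x * f x) \<partial>lebesgue)"
    unfolding weighted_measure_def using weight_measurable
    by (simp add: emeasure_density)
  moreover have "AE x in lebesgue. 0 \<le> indicator S x * f x"
    using nonneg by (auto simp: indicator_def)
  ultimately show "emeasure (weighted_measure S f) (space (weighted_measure S f)) \<noteq> \<infinity>"
    by (simp add: nn_integral_eq_integral)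
qed

lemma integral_weighted_measure:
  fixes h :: "'a \<Rightarrow> real"
  assumes "h \<in> borel_measurable lebesgue"
  shows "integral\<^sup>L (weighted_measure S f) h = (LINT x:S|lebesgue. h x * f x)"
proof -
  have "integral\<^sup>L (weighted_measure S f) h = (LINT x|lebesgue. (indicator S x * f x) *\<^sub>R h x)"
    unfolding weighted_measure_def using assms weight_measurable nonneg
    by (intro integral_density) (auto simp: indicator_def)
  then show ?thesis unfolding set_lebesgue_integral_def by (simp add: mult_ac)
qed

lemma AE_weighted_measure:
  assumes "AE x in lebesgue. x \<in> S \<longrightarrow> R x"
  shows "AE x in weighted_measure S f. R x"
  unfolding weighted_measure_def using weight_measurable assms
  by (subst AE_density) (auto simp: indicator_def split: if_splits elim: eventually_mono)

end

section \<open>The convex function \<open>Vstar\<close>\<close>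

lemma Qfun_continuous_on:
  assumes "continuous_on S \<omega>"
  shows "continuous_on S (Qfun \<beta> \<omega> x)"
  unfolding Qfun_def using assms by (intro continuous_intros) simp_all

text \<open>A continuous function on the compact closure of \<open>T\<close> attains its supremum;
  boundedness and attainment are packaged together for later use.\<close>

lemma Vstar_attained:
  assumes "bounded T" "T \<noteq> {}" "continuous_on (closure T) \<omega>"
  obtains p where "p \<in> closure T" "Vstar T \<beta> \<omega> x = Qfun \<beta> \<omega> x p"
    "\<And>q. q \<in> closure T \<Longrightarrow> Qfun \<beta> \<omega> x q \<le> Vstar T \<beta> \<omega> x"
proof -
  obtain p where p: "p \<in> closure T" "\<forall>q\<in>closure T. Qfun \<beta> \<omega> x q \<le> Qfun \<beta> \<omega> x p"
    using continuous_attains_sup[OF _ _ Qfun_continuous_on[OF assms(3)], of \<beta> x]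
      assms(1,2) compact_closure by auto
  then have "Vstar T \<beta> \<omega> x = Qfun \<beta> \<omega> x p"
    unfolding Vstar_def by (intro cSup_eq_maximum) auto
  with p that show ?thesis by metis
qed

text \<open>As a function of its first point argument, \<open>Qfun\<close> at \<open>p\<close> is
  affine with slope \<open>p\<close>, lies below \<open>Vstar\<close> and touches it at
  \<open>x\<close>. The converse can fail: subdifferentials are convex, sets of maximizers need not
  be.\<close>

lemma Qfun_maximizer_in_ray_map:
  assumes "bounded T" "T \<noteq> {}" "continuous_on (closure T) \<omega>"
    and "p \<in> closure T" "Qfun \<beta> \<omega> x p = Vstar T \<beta> \<omega> x"
  shows "p \<in> ray_map T \<beta> \<omega> x"
  unfolding ray_map_def subdifferential_def
proof safe
  fix y
  obtain q where "\<And>q. q \<in> closure T \<Longrightarrow> Qfun \<beta> \<omega> y q \<le> Vstar T \<beta> \<omega> y"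
    using Vstar_attained[OF assms(1-3)] by metis
  then have "Qfun \<beta> \<omega> y p \<le> Vstar T \<beta> \<omega> y" using assms(4) by blast
  moreover have "Qfun \<beta> \<omega> y p = Qfun \<beta> \<omega> x p + p \<bullet> (y - x)"
    unfolding Qfun_def by (simp add: inner_diff_right inner_commute)
  ultimately show "Vstar T \<beta> \<omega> x + p \<bullet> (y - x) \<le> Vstar T \<beta> \<omega> y" using assms(5) by simp
qed

text \<open>A maximum of affine functions whose slopes have norm at most \<open>B\<close> is
  \<open>B\<close>-Lipschitz.\<close>

lemma Vstar_continuous:
  fixes T :: "(real^'n) set"
  assumes "bounded T" "T \<noteq> {}" "continuous_on (closure T) \<omega>"
  shows "continuous_on S (Vstar T \<beta> \<omega>)"
proof -
  obtain B where B: "B > 0" "\<And>p. p \<in> closure T \<Longrightarrow> norm p \<le> B"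
    using assms(1) bounded_closure bounded_pos by metis
  have le: "Vstar T \<beta> \<omega> x - Vstar T \<beta> \<omega> y \<le> B * dist x y" for x y
  proof -
    obtain p where p: "p \<in> closure T" "Vstar T \<beta> \<omega> x = Qfun \<beta> \<omega> x p"
      using Vstar_attained[OF assms] by metis
    have "Qfun \<beta> \<omega> y p \<le> Vstar T \<beta> \<omega> y" using Vstar_attained[OF assms] p(1) by metis
    then have "Vstar T \<beta> \<omega> x - Vstar T \<beta> \<omega> y \<le> (x - y) \<bullet> p"
      using p(2) unfolding Qfun_def by (simp add: inner_diff_left)
    also have "\<dots> \<le> norm (x - y) * norm p" by (rule norm_cauchy_schwarz)
    also have "\<dots> \<le> norm (x - y) * B" using B(2)[OF p(1)] by (rule mult_left_mono) simp
    finally show ?thesis by (simp add: dist_norm mult.commute)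
  qed
  have "B-lipschitz_on S (Vstar T \<beta> \<omega>)"
  proof (rule lipschitz_onI)
    show "dist (Vstar T \<beta> \<omega> x) (Vstar T \<beta> \<omega> y) \<le> B * dist x y" for x y
      using le[of x y] le[of y x] by (simp add: dist_real_def dist_commute abs_le_iff)
  qed (use B in simp)
  then show ?thesis by (rule lipschitz_on_continuous_on)
qed

section \<open>The reflector problem in terms of a transport cost\<close>

locale two_reflector_problem =
  fixes \<Omega> T :: "(real^'n) set" and \<beta> :: real and I L z w :: "real^'n \<Rightarrow> real"
  assumes dom: "is_domain \<Omega>" "bounded \<Omega>" "is_domain T" "bounded T"
    and \<beta>: "\<beta> > 0"
    and I: "\<And>x. x \<in> \<Omega> \<Longrightarrow> I x \<ge> 0" "set_integrable lebesgue \<Omega> I"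
    and L: "\<And>p. p \<in> T \<Longrightarrow> L p \<ge> 0" "set_integrable lebesgue T L"
    and balance: "(LINT p:T|lebesgue. L p) = (LINT x:\<Omega>|lebesgue. I x)"
    and reflector: "two_reflector_A \<Omega> T \<beta> z w"
begin

definition cost :: "real^'n \<Rightarrow> real^'n \<Rightarrow> real" where
  "cost x p = 1 / (2 * \<beta>) * (\<beta>\<^sup>2 - (norm (x - p))\<^sup>2)"

text \<open>This is the c-transform of \<open>\<omega>\<close>: the maximum of
  \<open>cost x p + \<omega> p\<close> over the closure of \<open>T\<close>, hence the least
  admissible partner of \<open>\<omega>\<close> on the closure of \<open>\<Omega>\<close>. Writing
  it through \<open>Vstar\<close> gives continuity at once.\<close>

definition envelope :: "(real^'n \<Rightarrow> real) \<Rightarrow> real^'n \<Rightarrow> real" where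
  "envelope \<omega> x = (\<beta>\<^sup>2 - (norm x)\<^sup>2) / (2 * \<beta>) + Vstar T \<beta> \<omega> x / \<beta>"

text \<open>A selection of maximizers, standing for the map \<open>P\<close> of the overview. The
  choice matters only where the subgradient is not unique, which is a null set.\<close>

definition ray :: "real^'n \<Rightarrow> real^'n" where
  "ray x = (SOME p. p \<in> closure T \<and> Qfun \<beta> w x p = Vstar T \<beta> w x)"

definition source :: "(real^'n) measure" where
  "source = weighted_measure \<Omega> I"

text \<open>The identity map only restricts the measure from Lebesgue to Borel sets, so that it can
  be equal to \<open>transported\<close>.\<close>

definition target :: "(real^'n) measure" where
  "target = distr (weighted_measure T L) borel (\<lambda>p. p)"

definition transported :: "(real^'n) measure" where
  "transported = distr source borel ray"

lemma open_dom: "open \<Omega>" "\<Omega> \<noteq> {}" "open T" "T \<noteq> {}"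
  using dom unfolding is_domain_def by auto

lemma T_borel: "T \<in> sets borel"
  using open_dom by auto

lemma compact_dom: "compact (closure \<Omega>)" "compact (closure T)"
  using dom by (simp_all add: compact_closure)

lemma reflector_continuous: "continuous_on (closure \<Omega>) z" "continuous_on (closure T) w"
  using reflector unfolding two_reflector_A_def by auto

text \<open>Expanding the square separates a term in \<open>x\<close> alone from \<open>Qfun\<close>
  divided by \<open>\<beta>\<close>. Maximizing \<open>cost x p + \<omega> p\<close> over
  \<open>p\<close> is therefore the same as maximizing \<open>Qfun\<close>.\<close>

lemma cost_Qfun: "cost x p + \<omega> p = (\<beta>\<^sup>2 - (norm x)\<^sup>2) / (2 * \<beta>) + Qfun \<beta> \<omega> x p / \<beta>"
proof -
  have expand: "(norm (x - p))\<^sup>2 = (norm x)\<^sup>2 - 2 * (x \<bullet> p) + (norm p)\<^sup>2"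
    by (simp add: power2_norm_eq_inner inner_diff_left inner_diff_right inner_commute)
  show ?thesis unfolding cost_def Qfun_def expand using \<beta> by (simp add: field_simps power2_eq_square)
qed

lemma cost_parab: "parab_k \<beta> p v x = cost x p + v" "parab_h \<beta> x v p = v - cost x p"
  unfolding parab_k_def parab_h_def cost_def using \<beta> by (simp_all add: field_simps)

lemma envelope_ge:
  assumes "continuous_on (closure T) \<omega>" "p \<in> closure T"
  shows "cost x p + \<omega> p \<le> envelope \<omega> x"
proof -
  have "Qfun \<beta> \<omega> x p \<le> Vstar T \<beta> \<omega> x"
    using Vstar_attained[OF dom(4) open_dom(4) assms(1)] assms(2) by metis
  then show ?thesis
    unfolding cost_Qfun envelope_def using \<beta> by (simp add: divide_right_mono)
qed

lemma envelope_continuous: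
  assumes "continuous_on (closure T) \<omega>"
  shows "continuous_on S (envelope \<omega>)"
  unfolding envelope_def using \<beta> dom open_dom assms
  by (intro continuous_intros Vstar_continuous) auto

lemma Adm_iff: "(\<zeta>, \<omega>) \<in> Adm \<Omega> T \<beta> \<longleftrightarrow>
    continuous_on (closure \<Omega>) \<zeta> \<and> continuous_on (closure T) \<omega> \<and>
    (\<forall>x\<in>closure \<Omega>. \<forall>p\<in>closure T. cost x p + \<omega> p \<le> \<zeta> x)"
  unfolding Adm_def cost_def by (auto simp: algebra_simps)

lemma envelope_Adm:
  assumes "continuous_on (closure T) \<omega>"
  shows "(envelope \<omega>, \<omega>) \<in> Adm \<Omega> T \<beta>"
  unfolding Adm_iff using assms envelope_ge envelope_continuous by blast

text \<open>The first equation of a type A reflector takes the supremum of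
  \<open>cost x p + w p\<close>, which is attained at a maximizer of \<open>Qfun\<close>.\<close>

lemma reflector_envelope:
  assumes "x \<in> closure \<Omega>"
  shows "z x = envelope w x"
proof -
  obtain p where p: "p \<in> closure T" "Vstar T \<beta> w x = Qfun \<beta> w x p"
    using Vstar_attained[OF dom(4) open_dom(4) reflector_continuous(2)] by metis
  have "z x = (SUP p\<in>closure T. cost x p + w p)"
    using reflector assms unfolding two_reflector_A_def cost_parab by blast
  also have "\<dots> = cost x p + w p"
  proof (rule cSup_eq_maximum)
    show "cost x p + w p \<in> (\<lambda>p. cost x p + w p) ` closure T" using p(1) by blast
    show "y \<le> cost x p + w p" if "y \<in> (\<lambda>p. cost x p + w p) ` closure T" for y
      using that envelope_ge[OF reflector_continuous(2), of _ x] p(2)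
      by (auto simp: envelope_def cost_Qfun)
  qed
  finally show ?thesis unfolding cost_Qfun envelope_def p(2) .
qed

lemma reflector_Adm: "(z, w) \<in> Adm \<Omega> T \<beta>"
  using envelope_Adm[OF reflector_continuous(2)] reflector_continuous
  unfolding Adm_iff by (simp add: reflector_envelope)

lemma ray_maximizer: "ray x \<in> closure T" "Qfun \<beta> w x (ray x) = Vstar T \<beta> w x"
proof -
  have "\<exists>p. p \<in> closure T \<and> Qfun \<beta> w x p = Vstar T \<beta> w x"
    using Vstar_attained[OF dom(4) open_dom(4) reflector_continuous(2)] by metis
  from someI_ex[OF this] show "ray x \<in> closure T" "Qfun \<beta> w x (ray x) = Vstar T \<beta> w x"
    unfolding ray_def by auto
qed

lemma maximizer_in_ray_map:
  assumes "p \<in> closure T" "Qfun \<beta> w x p = Vstar T \<beta> w x"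
  shows "p \<in> ray_map T \<beta> w x"
  using Qfun_maximizer_in_ray_map[OF dom(4) open_dom(4) reflector_continuous(2) assms] .

text \<open>The equality case of admissibility, on which the minimality of \<open>(z, w)\<close>
  rests.\<close>

lemma reflector_ray:
  assumes "x \<in> closure \<Omega>"
  shows "z x - w (ray x) = cost x (ray x)"
  using cost_Qfun[of x "ray x" w] ray_maximizer(2)[of x]
  unfolding reflector_envelope[OF assms] envelope_def by simp

text \<open>By the second reflector equation \<open>w p\<close> is an infimum over a compact set. At
  a minimizing \<open>x\<close> the point \<open>p\<close> attains the envelope, so it is a
  subgradient there. Condition (i) of a weak solution thus follows from the reflector
  equations.\<close>

lemma ray_map_onto:
  assumes "p \<in> closure T"
  shows "\<exists>x\<in>closure \<Omega>. p \<in> ray_map T \<beta> w x"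
proof -
  have "continuous_on (closure \<Omega>) (\<lambda>x. z x - cost x p)"
    unfolding cost_def using reflector_continuous(1) by (intro continuous_intros)
  then obtain x where x: "x \<in> closure \<Omega>" "\<forall>y\<in>closure \<Omega>. z x - cost x p \<le> z y - cost y p"
    using continuous_attains_inf[OF compact_dom(1)] open_dom(2) by fastforce
  have "w p = (INF x\<in>closure \<Omega>. z x - cost x p)"
    using reflector assms unfolding two_reflector_A_def cost_parab by blast
  also have "\<dots> = z x - cost x p"
    using x by (intro cInf_eq_minimum) auto
  finally have "Qfun \<beta> w x p = Vstar T \<beta> w x"
    using cost_Qfun[of x p w] reflector_envelope[OF x(1)] \<beta> unfolding envelope_def by simp
  then show ?thesis using maximizer_in_ray_map assms x(1) by blast
qed

section \<open>Single-valuedness and measurability of the ray tracing map\<close>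

definition singular :: "(real^'n) set" where
  "singular = {x. \<exists>p q. p \<in> ray_map T \<beta> w x \<and> q \<in> ray_map T \<beta> w x \<and> p \<noteq> q}"

lemma negligible_singular: "negligible singular"
  unfolding singular_def ray_map_def
  by (rule negligible_subdifferential_not_unique)
    (rule Vstar_continuous[OF dom(4) open_dom(4) reflector_continuous(2)])

lemma AE_regular: "AE x in lebesgue. x \<notin> singular"
  using negligible_singular by (simp add: negligible_iff_null_sets AE_not_in)

text \<open>The chosen maximizer is always a subgradient, and off \<open>singular\<close> there is
  no other.\<close>

lemma ray_map_regular:
  assumes "x \<notin> singular"
  shows "ray_map T \<beta> w x = {ray x}"
  using assms maximizer_in_ray_map[OF ray_maximizer] unfolding singular_def by blast

text \<open>Lebesgue measure is complete, so changing a set inside a null set preserves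
  measurability.\<close>

lemma lebesgue_sets_modulo_singular:
  assumes "A \<in> sets lebesgue" "A - singular = B - singular"
  shows "B \<in> sets lebesgue"
proof -
  have "negligible (B \<inter> singular)" using negligible_singular negligible_subset by blast
  then have "(A - singular) \<union> (B \<inter> singular) \<in> sets lebesgue"
    using assms(1) negligible_imp_sets[OF negligible_singular] negligible_imp_sets by blast
  moreover have "B = (A - singular) \<union> (B \<inter> singular)" using assms(2) by blast
  ultimately show ?thesis by simp
qed

lemma ray_measurable: "ray \<in> lebesgue \<rightarrow>\<^sub>M borel"
proof (rule borel_measurableI)
  fix S :: "(real^'n) set" assume S: "open S"
  \<comment> \<open>Borel preimages under the set-valued map are available for closed sets, hence
    the passage to the complement of \<open>S\<close>. Off \<open>singular\<close> this preimage is
    the one under \<open>ray\<close>.\<close>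
  have "{x. ray_map T \<beta> w x \<inter> - S \<noteq> {}} \<in> sets lebesgue"
    unfolding ray_map_def
    using borel_subdifferential_preimage[OF
        Vstar_continuous[OF dom(4) open_dom(4) reflector_continuous(2)]] S
    by (simp add: closed_Compl)
  then have "ray -` (- S) \<in> sets lebesgue"
    by (rule lebesgue_sets_modulo_singular) (auto simp: ray_map_regular)
  then have "UNIV - ray -` (- S) \<in> sets lebesgue" using sets.compl_sets[of _ lebesgue] by simp
  moreover have "UNIV - ray -` (- S) = ray -` S \<inter> space lebesgue" by auto
  ultimately show "ray -` S \<inter> space lebesgue \<in> sets lebesgue" by simp
qed

section \<open>The source measure, its image and the target measure\<close>

lemma sets_source [measurable_cong]: "sets source = sets lebesgue"
  unfolding source_def using sets_weighted_measure[OF I(2,1)] .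

lemma ray_measurable_source [measurable]: "ray \<in> source \<rightarrow>\<^sub>M borel"
  using ray_measurable measurable_cong_sets[OF sets_source refl] by blast

lemma id_measurable: "(\<lambda>p. p) \<in> weighted_measure T L \<rightarrow>\<^sub>M borel"
  using borel_measurable_lebesgueI[OF measurable_ident_sets[OF refl]]
    measurable_cong_sets[OF sets_weighted_measure[OF L(2,1)] refl] by blast

lemma finite_source: "finite_measure source"
  unfolding source_def using finite_weighted_measure[OF I(2,1)] .

lemma finite_transported: "finite_measure transported"
  unfolding transported_def
  by (rule finite_measure.finite_measure_distr[OF finite_source ray_measurable_source])

lemma finite_target: "finite_measure target"
  unfolding target_def
  by (rule finite_measure.finite_measure_distr[OF finite_weighted_measure[OF L(2,1)] id_measurable])

lemma sets_images: "sets transported = sets borel" "sets target = sets borel"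
  unfolding transported_def target_def by simp_all

lemma integral_source:
  fixes h :: "real^'n \<Rightarrow> real"
  assumes "h \<in> borel_measurable lebesgue"
  shows "integral\<^sup>L source h = (LINT x:\<Omega>|lebesgue. h x * I x)"
  unfolding source_def using integral_weighted_measure[OF I(2,1) assms] .

lemma integral_transported:
  fixes g :: "real^'n \<Rightarrow> real"
  assumes "g \<in> borel_measurable borel"
  shows "integral\<^sup>L transported g = integral\<^sup>L source (\<lambda>x. g (ray x))"
  unfolding transported_def using assms by (intro integral_distr) measurable

lemma integral_target:
  fixes g :: "real^'n \<Rightarrow> real"
  assumes "g \<in> borel_measurable borel"
  shows "integral\<^sup>L target g = (LINT p:T|lebesgue. g p * L p)"
proof -
  have "integral\<^sup>L target g = integral\<^sup>L (weighted_measure T L) g"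
    unfolding target_def using integral_distr[OF id_measurable assms] by simp
  also have "\<dots> = (LINT p:T|lebesgue. g p * L p)"
    using assms by (intro integral_weighted_measure[OF L(2,1)] borel_measurable_lebesgueI)
  finally show ?thesis .
qed

lemma measure_target:
  assumes "\<tau> \<in> sets borel" "\<tau> \<subseteq> T"
  shows "measure target \<tau> = (LINT p:\<tau>|lebesgue. L p)"
proof -
  have "measure target \<tau> = integral\<^sup>L target (indicator \<tau>)"
    using assms(1) sets_images by (simp add: sets.Int_space_eq2)
  also have "\<dots> = (LINT p:T|lebesgue. indicator \<tau> p * L p)"
    using assms(1) by (intro integral_target) simp
  also have "\<dots> = (LINT p:\<tau>|lebesgue. L p)"
    unfolding set_lebesgue_integral_def using assms(2)
    by (intro Bochner_Integration.integral_cong) (auto simp: indicator_def)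
  finally show ?thesis .
qed

text \<open>Off the null set \<open>singular\<close>, the preimage under the set-valued map is the
  preimage under \<open>ray\<close>. Hence the left side of the mass condition (ii) is a
  push-forward measure.\<close>

lemma measure_transported:
  assumes "\<tau> \<in> sets borel"
  shows "measure transported \<tau> =
    (LINT x:ray_map_preimage T \<beta> w \<tau>|lebesgue. (if x \<in> \<Omega> then I x else 0))"
proof -
  have ind: "indicator \<tau> \<circ> ray \<in> borel_measurable lebesgue"
    by (rule measurable_comp[OF ray_measurable]) (use assms in simp)
  have "ray -` \<tau> \<in> sets lebesgue"
    using measurable_sets[OF ray_measurable assms] by simp
  then have pre: "ray_map_preimage T \<beta> w \<tau> \<in> sets lebesgue"
    by (rule lebesgue_sets_modulo_singular) (auto simp: ray_map_regular ray_map_preimage_def)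
  have I_meas: "(\<lambda>x. indicator \<Omega> x * I x) \<in> borel_measurable lebesgue"
    using weight_measurable[OF I(2,1)] .
  have "measure transported \<tau> = integral\<^sup>L transported (indicator \<tau>)"
    using assms sets_images by (simp add: sets.Int_space_eq2)
  also have "\<dots> = integral\<^sup>L source (\<lambda>x. indicator \<tau> (ray x))"
    using assms by (intro integral_transported) simp
  also have "\<dots> = (LINT x:\<Omega>|lebesgue. indicator \<tau> (ray x) * I x)"
    using ind by (intro integral_source) (simp add: comp_def)
  also have "\<dots> = (LINT x|lebesgue. indicator \<tau> (ray x) * (indicator \<Omega> x * I x))"
    unfolding set_lebesgue_integral_def by (simp add: mult_ac)
  also have "\<dots> = (LINT x|lebesgue. indicator (ray_map_preimage T \<beta> w \<tau>) x * (indicator \<Omega> x * I x))"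
  proof (rule integral_cong_AE)
    show "(\<lambda>x. indicator \<tau> (ray x) * (indicator \<Omega> x * I x)) \<in> borel_measurable lebesgue"
      by (rule borel_measurable_times[OF ind[unfolded comp_def] I_meas])
    show "(\<lambda>x. indicator (ray_map_preimage T \<beta> w \<tau>) x * (indicator \<Omega> x * I x))
        \<in> borel_measurable lebesgue"
      by (rule borel_measurable_times[OF borel_measurable_indicator[OF pre] I_meas])
    show "AE x in lebesgue. indicator \<tau> (ray x) * (indicator \<Omega> x * I x) =
        indicator (ray_map_preimage T \<beta> w \<tau>) x * (indicator \<Omega> x * I x)"
      using AE_regular
      by eventually_elim (simp add: ray_map_preimage_def ray_map_regular indicator_def)
  qed
  also have "\<dots> = (LINT x:ray_map_preimage T \<beta> w \<tau>|lebesgue. (if x \<in> \<Omega> then I x else 0))"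
    unfolding set_lebesgue_integral_def
    by (intro Bochner_Integration.integral_cong) (auto simp: indicator_def)
  finally show ?thesis .
qed

text \<open>Here the balance of \<open>I\<close> and \<open>L\<close> enters. It serves to exclude
  mass of \<open>transported\<close> outside \<open>T\<close>: \<open>ray\<close> takes values in
  the closure of \<open>T\<close>, whereas condition (ii) tests only subsets of
  \<open>T\<close>.\<close>

lemma total_mass: "measure transported UNIV = measure target UNIV" "measure target (- T) = 0"
proof -
  have "measure transported UNIV = integral\<^sup>L transported (\<lambda>_. 1)"
    by (simp add: transported_def)
  also have "\<dots> = (LINT x:\<Omega>|lebesgue. I x)"
    using integral_transported[of "\<lambda>_. 1"] integral_source[of "\<lambda>_. 1"] by simp
  finally have t: "measure transported UNIV = (LINT x:\<Omega>|lebesgue. I x)" .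
  have "measure target UNIV = integral\<^sup>L target (\<lambda>_. 1)"
    by (simp add: target_def)
  also have "\<dots> = (LINT p:T|lebesgue. L p)" using integral_target[of "\<lambda>_. 1"] by simp
  finally have u: "measure target UNIV = (LINT p:T|lebesgue. L p)" .
  show "measure transported UNIV = measure target UNIV" using t u balance by simp
  interpret finite_measure target by (rule finite_target)
  show "measure target (- T) = 0"
    using finite_measure_compl[of T] T_borel measure_target[OF T_borel] u sets_images
    by (simp add: target_def Compl_eq_Diff_UNIV)
qed

section \<open>Weak solutions as transport of the source to the target\<close>

lemma weak_solution_iff: "weak_solution_A \<Omega> T I L \<beta> z w \<longleftrightarrow> transported = target"
proof
  assume "transported = target"
  then show "weak_solution_A \<Omega> T I L \<beta> z w"
    unfolding weak_solution_A_def
    using reflector ray_map_onto measure_transported measure_target by simp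
next
  assume "weak_solution_A \<Omega> T I L \<beta> z w"
  then have eq: "measure transported \<tau> = measure target \<tau>" if "\<tau> \<in> sets borel" "\<tau> \<subseteq> T" for \<tau>
    using that measure_transported measure_target unfolding weak_solution_A_def by simp
  interpret M: finite_measure transported by (rule finite_transported)
  interpret N: finite_measure target by (rule finite_target)
  \<comment> \<open>The measures agree on \<open>T\<close> and in total mass, hence on the
    complement of \<open>T\<close>, where \<open>target\<close> vanishes.\<close>
  have "measure transported (- T) = measure target (- T)"
    using M.finite_measure_compl[of T] N.finite_measure_compl[of T] total_mass(1) sets_images
      eq[of T] T_borel by (simp add: target_def transported_def Compl_eq_Diff_UNIV)
  then have null: "measure transported (- T) = 0" "measure target (- T) = 0"
    using total_mass(2) by auto
  have restrict: "measure Q A = measure Q (A \<inter> T)"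
    if "finite_measure Q" "sets Q = sets borel" "measure Q (- T) = 0" "A \<in> sets borel" for Q A
  proof -
    interpret Q: finite_measure Q by fact
    have "measure Q A = measure Q (A \<inter> T) + measure Q (A - T)"
      using that(2,4) T_borel by (subst Q.finite_measure_Union[symmetric])
        (auto intro!: arg_cong[where f="measure Q"])
    moreover have "measure Q (A - T) \<le> measure Q (- T)"
      using that(2,4) T_borel by (intro Q.finite_measure_mono) auto
    ultimately show ?thesis using that(3) by (simp add: measure_le_0_iff)
  qed
  show "transported = target"
  proof (rule measure_eqI)
    fix A assume "A \<in> sets transported"
    then have A: "A \<in> sets borel" using sets_images by simp
    then have "measure transported A = measure target A"
      using restrict[OF finite_transported sets_images(1) null(1) A]
        restrict[OF finite_target sets_images(2) null(2) A] eq[of "A \<inter> T"] T_borel by simp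
    then show "emeasure transported A = emeasure target A"
      by (simp add: M.emeasure_eq_measure N.emeasure_eq_measure)
  qed (simp add: sets_images)
qed

section \<open>Minimizers as transport of the source to the target\<close>

lemma integrable_source:
  fixes h :: "real^'n \<Rightarrow> real"
  assumes "h \<in> borel_measurable lebesgue" "\<And>x. \<bar>h x\<bar> \<le> B"
  shows "integrable source h"
  using assms measurable_cong_sets[OF sets_source refl]
  by (intro finite_measure.integrable_const_bound[OF finite_source, where B=B]) auto

lemma transport_functional_eq:
  assumes "continuous_on (closure \<Omega>) \<zeta>" "continuous_on (closure T) \<omega>"
  shows "transport_functional \<Omega> T I L (\<zeta>, \<omega>) =
    (\<integral>x. indicator (closure \<Omega>) x * \<zeta> x \<partial>source) - (\<integral>p. indicator (closure T) p * \<omega> p \<partial>target)"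
proof -
  have "(\<integral>x. indicator (closure \<Omega>) x * \<zeta> x \<partial>source) =
      (LINT x:\<Omega>|lebesgue. (indicator (closure \<Omega>) x * \<zeta> x) * I x)"
    using indicator_extension(1)[OF compact_dom(1) assms(1)]
    by (intro integral_source borel_measurable_lebesgueI)
  also have "\<dots> = (LINT x:\<Omega>|lebesgue. \<zeta> x * I x)"
    unfolding set_lebesgue_integral_def using closure_subset[of \<Omega>]
    by (intro Bochner_Integration.integral_cong) (auto simp: indicator_def)
  finally have 1: "(\<integral>x. indicator (closure \<Omega>) x * \<zeta> x \<partial>source) = (LINT x:\<Omega>|lebesgue. \<zeta> x * I x)" .
  have "(\<integral>p. indicator (closure T) p * \<omega> p \<partial>target) =
      (LINT p:T|lebesgue. (indicator (closure T) p * \<omega> p) * L p)"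
    by (rule integral_target[OF indicator_extension(1)[OF compact_dom(2) assms(2)]])
  also have "\<dots> = (LINT p:T|lebesgue. \<omega> p * L p)"
    unfolding set_lebesgue_integral_def using closure_subset[of T]
    by (intro Bochner_Integration.integral_cong) (auto simp: indicator_def)
  finally show ?thesis using 1 unfolding transport_functional_def by simp
qed

lemma AE_source: "AE x in source. x \<in> \<Omega> \<and> x \<notin> singular"
proof -
  have "AE x in source. x \<in> \<Omega>" "AE x in source. x \<notin> singular"
    unfolding source_def using AE_regular
    by (auto intro!: AE_weighted_measure[OF I(2,1)])
  then show ?thesis by simp
qed

text \<open>Replacing \<open>target\<close> by the image of \<open>source\<close> turns the
  functional into the integral of \<open>\<zeta> x - \<omega> (ray x)\<close> against
  \<open>source\<close>. The integrand is at least \<open>cost x (ray x)\<close> almost everywhere,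
  with equality for \<open>(z, w)\<close>.\<close>

lemma transported_eq_target_imp_minimal:
  assumes eq: "transported = target" and adm: "(\<zeta>, \<omega>) \<in> Adm \<Omega> T \<beta>"
  shows "transport_functional \<Omega> T I L (z, w) \<le> transport_functional \<Omega> T I L (\<zeta>, \<omega>)"
proof -
  have F: "transport_functional \<Omega> T I L (f, g) =
      (\<integral>x. indicator (closure \<Omega>) x * f x - indicator (closure T) (ray x) * g (ray x) \<partial>source)"
    and int: "integrable source (\<lambda>x. indicator (closure \<Omega>) x * f x - indicator (closure T) (ray x) * g (ray x))"
    if fg: "continuous_on (closure \<Omega>) f" "continuous_on (closure T) g" for f g
  proof -
    note f = indicator_extension[OF compact_dom(1) fg(1)]
    note g = indicator_extension[OF compact_dom(2) fg(2)]
    have 1: "integrable source (\<lambda>x. indicator (closure \<Omega>) x * f x)"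
      using f by (auto intro: integrable_source borel_measurable_lebesgueI)
    have "(\<lambda>p. indicator (closure T) p * g p) \<circ> ray \<in> borel_measurable lebesgue"
      using ray_measurable g(1) by (rule measurable_comp)
    then have 2: "integrable source (\<lambda>x. indicator (closure T) (ray x) * g (ray x))"
      using g(2) by (auto intro: integrable_source simp: comp_def)
    from 1 2 show "integrable source (\<lambda>x. indicator (closure \<Omega>) x * f x - indicator (closure T) (ray x) * g (ray x))"
      by simp
    show "transport_functional \<Omega> T I L (f, g) =
      (\<integral>x. indicator (closure \<Omega>) x * f x - indicator (closure T) (ray x) * g (ray x) \<partial>source)"
      using transport_functional_eq[OF fg] integral_transported[OF g(1)] 1 2 eq by simp
  qed
  show ?thesis
    using adm reflector_continuous unfolding Adm_iff
  proof (simp only: F, intro integral_mono_AE int)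
    show "AE x in source.
        indicator (closure \<Omega>) x * z x - indicator (closure T) (ray x) * w (ray x)
        \<le> indicator (closure \<Omega>) x * \<zeta> x - indicator (closure T) (ray x) * \<omega> (ray x)"
      using AE_source
    proof eventually_elim
      case (elim x)
      then have x: "x \<in> closure \<Omega>" using closure_subset by blast
      then have "cost x (ray x) + \<omega> (ray x) \<le> \<zeta> x"
        using adm ray_maximizer(1) unfolding Adm_iff by blast
      then show ?case using reflector_ray[OF x] x ray_maximizer(1)[of x] by simp
    qed
  qed auto
qed

text \<open>The first variation in the direction \<open>g\<close>: \<open>w\<close> is perturbed to
  \<open>w + \<epsilon> g\<close> and paired with its envelope. The difference quotients of the
  envelopes converge to \<open>g (ray x)\<close> almost everywhere and are bounded by
  \<open>1\<close>.\<close>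

lemma minimal_imp_integral_le:
  assumes min: "\<And>\<zeta> \<omega>. (\<zeta>, \<omega>) \<in> Adm \<Omega> T \<beta> \<Longrightarrow>
      transport_functional \<Omega> T I L (z, w) \<le> transport_functional \<Omega> T I L (\<zeta>, \<omega>)"
    and g: "continuous_on UNIV g" "\<And>p. \<bar>g p\<bar> \<le> (1::real)"
  shows "integral\<^sup>L target g \<le> integral\<^sup>L transported g"
proof -
  define \<epsilon> where "\<epsilon> k = 1 / real (Suc k)" for k
  have \<epsilon>: "\<epsilon> k > 0" for k unfolding \<epsilon>_def by simp
  have \<epsilon>0: "\<epsilon> \<longlonglongrightarrow> 0" unfolding \<epsilon>_def using LIMSEQ_inverse_real_of_nat by (simp add: inverse_eq_divide)
  define \<omega> where "\<omega> k p = w p + \<epsilon> k * g p" for k p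
  note gT = continuous_on_subset[OF g(1) subset_UNIV]
  have \<omega>: "continuous_on (closure T) (\<omega> k)" for k
    unfolding \<omega>_def using reflector_continuous(2) gT by (intro continuous_intros)
  define D where "D k x = indicator (closure \<Omega>) x * ((envelope (\<omega> k) x - envelope w x) / \<epsilon> k)" for k x
  have Dcont: "continuous_on (closure \<Omega>) (\<lambda>x. (envelope (\<omega> k) x - envelope w x) / \<epsilon> k)" for k
    using \<epsilon>[of k] by (intro continuous_intros envelope_continuous \<omega> reflector_continuous) auto
  have Dmeas: "D k \<in> borel_measurable borel" for k
    unfolding D_def using indicator_extension(1)[OF compact_dom(1) Dcont] .
  \<comment> \<open>A maximizer for the perturbed problem bounds the quotient from above by a value
    of \<open>g\<close>, and the unperturbed maximizer \<open>ray x\<close> bounds it from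
    below.\<close>
  have Dbound: "\<bar>D k x\<bar> \<le> 1" for k x
  proof -
    obtain p where p: "p \<in> closure T" "Vstar T \<beta> (\<omega> k) x = Qfun \<beta> (\<omega> k) x p"
      using Vstar_attained[OF dom(4) open_dom(4) \<omega>] by metis
    have "envelope (\<omega> k) x = cost x p + \<omega> k p"
      unfolding cost_Qfun envelope_def p(2) ..
    then have "envelope (\<omega> k) x \<le> envelope w x + \<epsilon> k * g p"
      using envelope_ge[OF reflector_continuous(2) p(1), of x] unfolding \<omega>_def by simp
    then have 1: "envelope (\<omega> k) x - envelope w x \<le> \<epsilon> k * g p" by simp
    have "envelope w x = cost x (ray x) + w (ray x)"
      unfolding cost_Qfun envelope_def ray_maximizer(2) ..
    then have 2: "\<epsilon> k * g (ray x) \<le> envelope (\<omega> k) x - envelope w x"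
      using envelope_ge[OF \<omega>[of k] ray_maximizer(1)[of x], of x] unfolding \<omega>_def by simp
    have "(envelope (\<omega> k) x - envelope w x) / \<epsilon> k \<le> g p"
      "g (ray x) \<le> (envelope (\<omega> k) x - envelope w x) / \<epsilon> k"
      using 1 2 \<epsilon>[of k] by (simp_all add: field_simps)
    then have "\<bar>(envelope (\<omega> k) x - envelope w x) / \<epsilon> k\<bar> \<le> 1"
      using g(2)[of p] g(2)[of "ray x"] by (simp add: abs_le_iff)
    then show ?thesis unfolding D_def by (simp add: indicator_def)
  qed
  have Dlim: "(\<lambda>k. D k x) \<longlonglongrightarrow> g (ray x)" if "x \<in> closure \<Omega>" "x \<notin> singular" for x
  proof -
    \<comment> \<open>\<open>Qfun\<close> is perturbed by \<open>\<beta> * \<epsilon> k\<close>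
      times \<open>g\<close>, so this product is the step size in the limit of the maxima; its
      factor \<open>\<beta>\<close> matches the division by \<open>\<beta>\<close> in
      \<open>envelope\<close>.\<close>
    have Q: "Qfun \<beta> (\<omega> k) x = (\<lambda>p. Qfun \<beta> w x p + (\<beta> * \<epsilon> k) * g p)" for k
      unfolding Qfun_def \<omega>_def by (auto simp: algebra_simps)
    have uniq: "Qfun \<beta> w x p < Qfun \<beta> w x (ray x)" if p: "p \<in> closure T" "p \<noteq> ray x" for p
    proof -
      have "Qfun \<beta> w x p \<noteq> Vstar T \<beta> w x"
        using maximizer_in_ray_map[OF p(1), of x] ray_map_regular[OF \<open>x \<notin> singular\<close>] p(2) by auto
      moreover have "Qfun \<beta> w x p \<le> Vstar T \<beta> w x"
        using Vstar_attained[OF dom(4) open_dom(4) reflector_continuous(2)] p(1) by metis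
      ultimately show ?thesis using ray_maximizer(2) by simp
    qed
    have "(\<lambda>k. \<beta> * \<epsilon> k) \<longlonglongrightarrow> \<beta> * 0" by (intro tendsto_intros \<epsilon>0)
    then have "(\<lambda>k. ((SUP p\<in>closure T. Qfun \<beta> w x p + (\<beta> * \<epsilon> k) * g p) - Qfun \<beta> w x (ray x))
        / (\<beta> * \<epsilon> k)) \<longlonglongrightarrow> g (ray x)"
      using \<beta> \<epsilon> by (intro SUP_perturbation_tendsto compact_dom Qfun_continuous_on
          reflector_continuous gT ray_maximizer uniq) auto
    moreover have "D k x = ((SUP p\<in>closure T. Qfun \<beta> w x p + (\<beta> * \<epsilon> k) * g p)
        - Qfun \<beta> w x (ray x)) / (\<beta> * \<epsilon> k)" for k
    proof -
      have "(SUP p\<in>closure T. Qfun \<beta> w x p + (\<beta> * \<epsilon> k) * g p) = Vstar T \<beta> (\<omega> k) x"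
        unfolding Vstar_def Q ..
      then show ?thesis
        unfolding D_def envelope_def ray_maximizer(2) using \<open>x \<in> closure \<Omega>\<close> \<beta> \<epsilon>[of k]
        by (simp add: diff_divide_distrib)
    qed
    ultimately show ?thesis by simp
  qed
  have gm: "g \<in> borel_measurable borel" using g(1) by (rule borel_measurable_continuous_onI)
  have "integral\<^sup>L target g \<le> integral\<^sup>L source (D k)" for k
  proof -
    have ib: "integrable source (\<lambda>x. indicator (closure \<Omega>) x * h x)"
      if "continuous_on (closure \<Omega>) h" for h :: "real^'n \<Rightarrow> real"
      using indicator_extension[OF compact_dom(1) that]
      by (auto intro: integrable_source borel_measurable_lebesgueI)
    have it: "integrable target (\<lambda>x. indicator (closure T) x * h x)"
      if h: "continuous_on (closure T) h" for h :: "real^'n \<Rightarrow> real"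
    proof -
      obtain B where "\<And>x. \<bar>indicator (closure T) x * h x\<bar> \<le> B"
        using indicator_extension(2)[OF compact_dom(2) h] by blast
      then show ?thesis
        using indicator_extension(1)[OF compact_dom(2) h] measurable_cong_sets[OF sets_images(2) refl]
        by (intro finite_measure.integrable_const_bound[OF finite_target, where B=B]) auto
    qed
    \<comment> \<open>The change of the functional is \<open>\<epsilon> k\<close> times the integral
      of \<open>D k\<close> minus that of \<open>g\<close>, and minimality makes it
      nonnegative.\<close>
    have "transport_functional \<Omega> T I L (z, w) \<le> transport_functional \<Omega> T I L (envelope (\<omega> k), \<omega> k)"
      by (rule min[OF envelope_Adm[OF \<omega>]])
    moreover have "transport_functional \<Omega> T I L (envelope (\<omega> k), \<omega> k) - transport_functional \<Omega> T I L (z, w)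
        = \<epsilon> k * integral\<^sup>L source (D k) - \<epsilon> k * integral\<^sup>L target g"
    proof -
      have "(\<integral>x. indicator (closure \<Omega>) x * envelope (\<omega> k) x \<partial>source)
          - (\<integral>x. indicator (closure \<Omega>) x * z x \<partial>source)
          = (\<integral>x. indicator (closure \<Omega>) x * envelope (\<omega> k) x - indicator (closure \<Omega>) x * z x \<partial>source)"
        by (intro Bochner_Integration.integral_diff[symmetric] ib envelope_continuous \<omega> reflector_continuous)
      also have "\<dots> = (\<integral>x. \<epsilon> k * D k x \<partial>source)"
        using \<epsilon>[of k] unfolding D_def
        by (intro Bochner_Integration.integral_cong) (auto simp: indicator_def reflector_envelope)
      finally have s: "(\<integral>x. indicator (closure \<Omega>) x * envelope (\<omega> k) x \<partial>source)
          - (\<integral>x. indicator (closure \<Omega>) x * z x \<partial>source) = \<epsilon> k * integral\<^sup>L source (D k)" by simp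
      have "(\<integral>p. indicator (closure T) p * \<omega> k p \<partial>target) - (\<integral>p. indicator (closure T) p * w p \<partial>target)
          = (\<integral>p. indicator (closure T) p * \<omega> k p - indicator (closure T) p * w p \<partial>target)"
        by (intro Bochner_Integration.integral_diff[symmetric] it \<omega> reflector_continuous)
      also have "\<dots> = (\<integral>p. \<epsilon> k * (indicator (closure T) p * g p) \<partial>target)"
        unfolding \<omega>_def by (intro Bochner_Integration.integral_cong) (auto simp: indicator_def)
      also have "\<dots> = \<epsilon> k * (\<integral>p. indicator (closure T) p * g p \<partial>target)" by simp
      also have "(\<integral>p. indicator (closure T) p * g p \<partial>target) = integral\<^sup>L target g"
      proof -
        have "(LINT p:T|lebesgue. (indicator (closure T) p * g p) * L p) = (LINT p:T|lebesgue. g p * L p)"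
          unfolding set_lebesgue_integral_def using closure_subset[of T]
          by (intro Bochner_Integration.integral_cong) (auto simp: indicator_def)
        then show ?thesis
          using integral_target[OF gm] integral_target[OF indicator_extension(1)[OF compact_dom(2) gT]] by simp
      qed
      finally show ?thesis
        using s transport_functional_eq[OF envelope_continuous[OF \<omega>[of k]] \<omega>[of k]]
          transport_functional_eq[OF reflector_continuous] by simp
    qed
    ultimately have "\<epsilon> k * integral\<^sup>L target g \<le> \<epsilon> k * integral\<^sup>L source (D k)" by simp
    then show ?thesis using \<epsilon>[of k] by simp
  qed
  moreover have "(\<lambda>k. integral\<^sup>L source (D k)) \<longlonglongrightarrow> integral\<^sup>L source (\<lambda>x. g (ray x))"
  proof (rule integral_dominated_convergence[where w="\<lambda>_. 1"])
    show "integrable source (\<lambda>_. 1::real)" by (rule integrable_source[where B=1]) auto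
    show "(\<lambda>x. g (ray x)) \<in> borel_measurable source" using gm by measurable
    show "D k \<in> borel_measurable source" for k
      using borel_measurable_lebesgueI[OF Dmeas] measurable_cong_sets[OF sets_source refl] by blast
    show "AE x in source. (\<lambda>k. D k x) \<longlonglongrightarrow> g (ray x)"
      using AE_source
    proof eventually_elim
      case (elim x)
      then show ?case using Dlim closure_subset by blast
    qed
  qed (use Dbound in auto)
  ultimately show ?thesis
    unfolding integral_transported[OF gm] by (intro LIMSEQ_le_const) auto
qed

lemma minimal_iff:
  "is_arg_min (transport_functional \<Omega> T I L) (\<lambda>\<zeta>\<omega>. \<zeta>\<omega> \<in> Adm \<Omega> T \<beta>) (z, w)
    \<longleftrightarrow> transported = target"
proof
  assume "transported = target"
  then show "is_arg_min (transport_functional \<Omega> T I L) (\<lambda>\<zeta>\<omega>. \<zeta>\<omega> \<in> Adm \<Omega> T \<beta>) (z, w)"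
    unfolding is_arg_min_def using reflector_Adm transported_eq_target_imp_minimal
    by (auto simp: not_less)
next
  assume "is_arg_min (transport_functional \<Omega> T I L) (\<lambda>\<zeta>\<omega>. \<zeta>\<omega> \<in> Adm \<Omega> T \<beta>) (z, w)"
  then have min: "transport_functional \<Omega> T I L (z, w) \<le> transport_functional \<Omega> T I L (\<zeta>, \<omega>)"
    if "(\<zeta>, \<omega>) \<in> Adm \<Omega> T \<beta>" for \<zeta> \<omega>
    using that unfolding is_arg_min_def by (meson not_le)
  show "transported = target"
  proof (rule finite_borel_measure_eqI[OF finite_transported finite_target sets_images])
    fix g :: "real^'n \<Rightarrow> real"
    assume g: "continuous_on UNIV g" "\<And>x. \<bar>g x\<bar> \<le> 1"
    \<comment> \<open>The one-sided inequality for \<open>- g\<close> is the reverse inequality for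
      \<open>g\<close>.\<close>
    have "integral\<^sup>L target (\<lambda>x. - g x) \<le> integral\<^sup>L transported (\<lambda>x. - g x)"
      using g by (intro minimal_imp_integral_le[OF min] continuous_intros) auto
    then show "integral\<^sup>L transported g = integral\<^sup>L target g"
      using minimal_imp_integral_le[OF min g] by simp
  qed
qed

end

theorem theorem5p2:
  fixes \<Omega> T :: "(real^'n) set" and \<beta> :: real
    and I L z w :: "real^'n \<Rightarrow> real"
  assumes "CARD('n) \<ge> 2"
    and "is_domain \<Omega>" and "bounded \<Omega>"
    and "is_domain T" and "bounded T"
    and "\<beta> > 0"
    and "\<And>x. x \<in> \<Omega> \<Longrightarrow> I x \<ge> 0" and "set_integrable lebesgue \<Omega> I"
    and "\<And>p. p \<in> T \<Longrightarrow> L p \<ge> 0" and "set_integrable lebesgue T L"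
    and "(LINT p:T|lebesgue. L p) = (LINT x:\<Omega>|lebesgue. I x)"
    and "two_reflector_A \<Omega> T \<beta> z w"
  shows "is_arg_min (transport_functional \<Omega> T I L) (\<lambda>\<zeta>\<omega>. \<zeta>\<omega> \<in> Adm \<Omega> T \<beta>) (z, w)
     \<longleftrightarrow> weak_solution_A \<Omega> T I L \<beta> z w"
proof -
  interpret two_reflector_problem \<Omega> T \<beta> I L z w
    by unfold_locales (use assms in auto)
  show ?thesis using minimal_iff weak_solution_iff by blast
qed

end
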